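(* Let $q$ be a complex number with $|q|\neq0,1$, let $a$ be a fixed complex number, let $d\ge1$, let $\boldsymbol{s}=(s_1,\ldots,s_d)\in\mathbb{Z}_{>0}^d$, and let $\boldsymbol{t}=(t_1,\ldots,t_d)$ be the variables of $R=\mathbb{C}[t_1,\ldots,t_d]$. Put $l(0)=0$, $l(i)=s_1+\cdots+s_i$ for $1\le i\le d$, and $w=l(d)$. Then for every integer $n\ge1$ the following identity holds in the commutative polynomial ring $R[x]$: $$ \begin{aligned} \sum_{k=1}^n\genfrac{[}{]}{0pt}{}{n}{k}q^{\binom{k}{2}}x^ka^{n-k}\,l_k^{\star,q}(\boldsymbol{s},\boldsymbol{t}) =\sum_{n\ge n_1\ge\cdots\ge n_w\ge1} &\frac{(x+a)^{[n-n_1]}}{[n_1]\cdots[n_w]} \left(\prod_{r=1}^{d-1}(q^{\,n-n_{l(r)}}t_rx+a)^{[n_{l(r)}-n_{l(r)+1}]}\right)\\ &\times\left((q^{\,n-n_{l(d)}}t_dx+a)^{[n_{l(d)}]}-a^{n_{l(d)}}\right)\\ &\times a^{\,n_1+n_{l(1)+1}+\cdots+n_{l(d-1)+1}-n_{l(1)}-\cdots-n_{l(d)}}. \end{aligned} $$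
   Context: For an integer $n\ge0$: $[n]=\frac{1-q^n}{1-q}$; $[n]!=[n][n-1]\cdots[1]$ for $n\ge1$ and $[0]!=1$. The $q$-binomial coefficient is $\genfrac{[}{]}{0pt}{}{n}{k}=\frac{[n]!}{[k]!\,[n-k]!}$ for $n\ge k\ge0$, and $0$ if $k>n$. For $k\in\mathbb{Z}_{>0}$, $$l_k^{\star,q}(\boldsymbol{s},\boldsymbol{t})=\sum_{k\ge n_1\ge\cdots\ge n_d\ge1}\frac{t_1^{n_1-n_2}\cdots t_{d-1}^{n_{d-1}-n_d}\,t_d^{n_d}}{[n_1]^{s_1}\cdots[n_d]^{s_d}}\in R.$$ For an integer $n\ge0$ and coefficients $\alpha,\beta$ (in $R$, not involving $x$), the bracketed power is $$(\alpha x+\beta)^{[n]}=\prod_{k=1}^n(q^{k-1}\alpha x+\beta)=(\alpha x+\beta)(q\alpha x+\beta)\cdots(q^{n-1}\alpha x+\beta),$$ with value $1$ for $n=0$. The exponent of $a$ in the last factor of the claim is $\sum_{r=1}^{d}(n_{l(r-1)+1}-n_{l(r)})\ge0$, and $a^0=1$. Empty products equal $1$. *)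

theory Defs
  imports Complex_Main "HOL-Library.Poly_Mapping" "HOL-Library.FuncSet"
    "HOL-Computational_Algebra.Polynomial"
begin

text \<open>
  Polynomials over \<open>\<complex>\<close> in indeterminates \<open>t\<^sub>0, t\<^sub>1, t\<^sub>2, \<dots>\<close>, as finitely supported maps from
  exponent vectors to coefficients, with the convolution product of \<^theory>\<open>HOL-Library.Poly_Mapping\<close>.
  The ring \<open>\<complex>[t\<^sub>1,\<dots>,t\<^sub>d]\<close> is the subring generated by \<open>Const c\<close> and
  \<open>Var 1, \<dots>, Var d\<close>; since the number \<open>d\<close> of indeterminates is a term and not a type,
  identities in \<open>\<complex>[t\<^sub>1,\<dots>,t\<^sub>d]\<close> are stated in the ambient ring, where they mention
  only these indeterminates.
\<close>

type_synonym tpoly = "(nat \<Rightarrow>\<^sub>0 nat) \<Rightarrow>\<^sub>0 complex"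

definition Const :: "complex \<Rightarrow> tpoly"
  where "Const c = Poly_Mapping.single 0 c"

definition Var :: "nat \<Rightarrow> tpoly"
  where "Var i = Poly_Mapping.single (Poly_Mapping.single i 1) 1"

definition q_int :: "complex \<Rightarrow> nat \<Rightarrow> complex"
  where "q_int q n = (1 - q ^ n) / (1 - q)"

definition q_fact :: "complex \<Rightarrow> nat \<Rightarrow> complex"
  where "q_fact q n = (\<Prod>i=1..n. q_int q i)"

definition q_binomial :: "complex \<Rightarrow> nat \<Rightarrow> nat \<Rightarrow> complex"
  where "q_binomial q n k =
    (if k \<le> n then q_fact q n / (q_fact q k * q_fact q (n - k)) else 0)"

text \<open>
  \<open>desc_chains d k\<close> is the set of all \<open>k \<ge> m\<^sub>1 \<ge> \<dots> \<ge> m\<^sub>d \<ge> 1\<close>. The maps are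
  extensional (undefined outside \<open>{1..d}\<close>), so that each chain is counted exactly once.
\<close>

definition desc_chains :: "nat \<Rightarrow> nat \<Rightarrow> (nat \<Rightarrow> nat) set"
  where "desc_chains d k = {m \<in> {1..d} \<rightarrow>\<^sub>E {1..k}. \<forall>i\<in>{1..<d}. m (i + 1) \<le> m i}"

definition l_star :: "complex \<Rightarrow> nat \<Rightarrow> nat \<Rightarrow> (nat \<Rightarrow> nat) \<Rightarrow> tpoly"
  where "l_star q k d s =
    (\<Sum>m\<in>desc_chains d k.
       Const (1 / (\<Prod>i=1..d. q_int q (m i) ^ s i))
       * ((\<Prod>i=1..<d. Var i ^ (m i - m (i + 1))) * Var d ^ m d))"

text \<open>
  The bracketed power \<open>(\<alpha> x + \<beta>)\<^bsup>[n]\<^esup>\<close>; the factor \<open>[:b, c:]\<close> is the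
  polynomial \<open>c x + b\<close> in \<open>x\<close>.
  Only the coefficient of \<open>x\<close> is multiplied by powers of \<open>q\<close>, so \<open>\<alpha>\<close> and \<open>\<beta>\<close> are separate arguments.
\<close>

definition bracket_power :: "complex \<Rightarrow> tpoly \<Rightarrow> tpoly \<Rightarrow> nat \<Rightarrow> tpoly poly"
  where "bracket_power q \<alpha> \<beta> n = (\<Prod>k=1..n. [:\<beta>, Const (q ^ (k - 1)) * \<alpha>:])"

end

theory Submission
  imports Defs
begin

text \<open>
  For a sequence \<open>f\<close> let \<open>T\<^sub>n(f; x) = \<Sum>\<^sub>k [n choose k] q\<^bsup>k(k-1)/2\<^esup> x\<^sup>k a\<^bsup>n-k\<^esup> f\<^sub>k\<close>,
  the sum running over \<open>1 \<le> k \<le> n\<close>. If \<open>g\<^sub>k = \<Sum>\<^sub>j t\<^bsup>k-j\<^esup> f\<^sub>j / [j]\<close> over \<open>1 \<le> j \<le> k\<close>, then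
  the \<open>q\<close>-Pascal rule and \<open>[n choose k] / [k+1] = [n+1 choose k+1] / [n+1]\<close> give
  \<open>T\<^sub>n\<^sub>+\<^sub>1(g; x) = (t x + a) T\<^sub>n(g; q x) + T\<^sub>n\<^sub>+\<^sub>1(f; x) / [n+1]\<close>, and iterating,
  \<open>T\<^sub>n(g; x) = \<Sum>\<^sub>j (t x + a)\<^bsup>[n-j]\<^esup> T\<^sub>j(f; q\<^bsup>n-j\<^esup> x) / [j]\<close>.
  The sequence \<open>k \<mapsto> l\<^sub>k\<close> of star sums arises from \<open>k \<mapsto> t\<^sub>d\<^sup>k\<close>, whose transform is given by the
  \<open>q\<close>-binomial theorem, by \<open>w\<close> such steps \<open>f \<mapsto> g\<close>: the step at the start of a block uses the
  parameter \<open>1\<close> (first block) or \<open>t\<^sub>r\<close>, all others use \<open>0\<close>. A step with parameter \<open>0\<close> only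
  divides \<open>f\<^sub>k\<close> by \<open>[k]\<close>, and its bracketed power is a power of \<open>a\<close>.
\<close>

section \<open>Sums over descending chains\<close>

text \<open>Entry 0 is set to \<open>k\<close> so that the first factor links the upper bound to
  \<open>m 1\<close>; the value is a \<open>w\<close>-fold product of triangular kernels applied to
  \<open>f\<close>.\<close>

definition chain_sum ::
    "(nat \<Rightarrow> nat \<Rightarrow> nat \<Rightarrow> 'a::comm_semiring_1) \<Rightarrow> nat \<Rightarrow> nat \<Rightarrow> (nat \<Rightarrow> 'a) \<Rightarrow> 'a"
  where "chain_sum \<phi> w k f =
    (\<Sum>m\<in>desc_chains w k.
       (\<Prod>i=1..w. \<phi> i ((m(0:=k)) (i - 1)) ((m(0:=k)) i)) * f ((m(0:=k)) w))"

lemma finite_desc_chains [simp]: "finite (desc_chains w k)"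
proof -
  have "finite ({1..w} \<rightarrow>\<^sub>E {1..k})" by (intro finite_PiE) auto
  thus ?thesis unfolding desc_chains_def by (rule rev_finite_subset) auto
qed

lemma desc_chains_bounds:
  assumes "m \<in> desc_chains w k" "i \<in> {1..w}"
  shows "1 \<le> m i" "m i \<le> k"
  using assms unfolding desc_chains_def by (auto simp: PiE_iff)

lemma desc_chains_step:
  assumes "m \<in> desc_chains w k" "1 \<le> i" "i < w"
  shows "m (Suc i) \<le> m i"
  using assms unfolding desc_chains_def by auto

lemma desc_chains_antimono:
  assumes "m \<in> desc_chains w k" "1 \<le> i" "i \<le> j" "j \<le> w"
  shows "m j \<le> m i"
  using assms(3,4)
proof (induction j rule: dec_induct)
  case (step j)
  then show ?case using desc_chains_step[OF assms(1), of j] assms(2) by auto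
qed simp

lemma desc_chains_0: "desc_chains 0 k = {\<lambda>_. undefined}"
  unfolding desc_chains_def by auto

lemma chain_sum_0 [simp]: "chain_sum \<phi> 0 k f = f k"
  by (simp add: chain_sum_def desc_chains_0)

lemma chain_sum_cong:
  assumes "\<And>j. j \<le> k \<Longrightarrow> f j = g j"
  shows "chain_sum \<phi> w k f = chain_sum \<phi> w k g"
  unfolding chain_sum_def
proof (intro sum.cong refl arg_cong2[where f = "(*)"] assms)
  fix m assume "m \<in> desc_chains w k"
  then show "(m(0:=k)) w \<le> k" using desc_chains_bounds[of m w k w] by (cases "w = 0") auto
qed

lemma desc_chains_extend:
  assumes "m \<in> desc_chains w k" "1 \<le> j" "j \<le> (m(0:=k)) w"
  shows "m(Suc w := j) \<in> desc_chains (Suc w) k"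
proof -
  have "(m(0:=k)) w \<le> k" using desc_chains_bounds[OF assms(1), of w] by (cases "w = 0") auto
  then show ?thesis
    using assms unfolding desc_chains_def
    by (auto simp: PiE_iff extensional_def less_Suc_eq)
qed

lemma desc_chains_restrict:
  assumes "m \<in> desc_chains (Suc w) k"
  shows "m(Suc w := undefined) \<in> desc_chains w k"
  using assms unfolding desc_chains_def
  by (auto simp: PiE_iff extensional_def)

text \<open>Splitting off the smallest entry turns the last kernel into an operator on
  \<open>f\<close>, so inductions on the length handle one summation step at a time.\<close>

lemma chain_sum_Suc:
  "chain_sum \<phi> (Suc w) k f = chain_sum \<phi> w k (\<lambda>p. \<Sum>j=1..p. \<phi> (Suc w) p j * f j)"
proof -
  let ?g = "\<lambda>m. \<Prod>i=1..w. \<phi> i ((m(0:=k)) (i - 1)) ((m(0:=k)) i)"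
  have "chain_sum \<phi> w k (\<lambda>p. \<Sum>j=1..p. \<phi> (Suc w) p j * f j)
      = (\<Sum>m\<in>desc_chains w k. \<Sum>j\<in>{1..(m(0:=k)) w}. ?g m * (\<phi> (Suc w) ((m(0:=k)) w) j * f j))"
    by (simp add: chain_sum_def sum_distrib_left del: fun_upd_apply)
  also have "\<dots> = (\<Sum>(m, j)\<in>Sigma (desc_chains w k) (\<lambda>m. {1..(m(0:=k)) w}).
                 ?g m * (\<phi> (Suc w) ((m(0:=k)) w) j * f j))"
    by (rule sum.Sigma) auto
  also have "\<dots> = chain_sum \<phi> (Suc w) k f"
    unfolding chain_sum_def
  proof (rule sum.reindex_bij_witness[where j = "\<lambda>(m, j). m(Suc w := j)"
        and i = "\<lambda>m. (m(Suc w := undefined), m (Suc w))"], goal_cases)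
    case (1 p)
    then obtain m j where p: "p = (m, j)" "m \<in> desc_chains w k" by auto
    have "m (Suc w) = undefined" using p(2) unfolding desc_chains_def
      by (auto simp: PiE_iff extensional_def)
    then show ?case using p by auto
  next
    case (2 p)
    then show ?case using desc_chains_extend by auto
  next
    case (4 m)
    \<comment> \<open>For \<open>w = 0\<close> the predecessor of the last entry is
      \<open>k\<close>, for \<open>w > 0\<close> it is \<open>m w\<close>; hence both upper
      bounds.\<close>
    have "1 \<le> m (Suc w)" "m (Suc w) \<le> k" using desc_chains_bounds[OF 4, of "Suc w"] by auto
    moreover have "w \<noteq> 0 \<Longrightarrow> m (Suc w) \<le> m w" using desc_chains_step[OF 4, of w] by auto
    ultimately show ?case using desc_chains_restrict[OF 4] by auto
  next
    case (5 p)
    then obtain m j where p: "p = (m, j)" by auto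
    have "(\<Prod>i=1..w. \<phi> i (((m(Suc w := j))(0:=k)) (i - 1)) (((m(Suc w := j))(0:=k)) i)) = ?g m"
      by (intro prod.cong) auto
    then show ?case using p by (simp add: mult.assoc)
  qed simp
  finally show ?thesis ..
qed

section \<open>Quantum integers and binomial coefficients\<close>

text \<open>A zero of [n] would make \<open>q\<close> a root of unity, hence of norm 1.\<close>

lemma q_int_nonzero:
  assumes "norm q \<noteq> 1" "n \<ge> 1"
  shows "q_int q n \<noteq> 0"
proof
  assume "q_int q n = 0"
  moreover have "q \<noteq> 1" using assms by auto
  ultimately have "q ^ n = 1" by (simp add: q_int_def)
  then have "norm q ^ n = 1" by (metis norm_power norm_one)
  then show False using assms power_eq_1_iff by fastforce
qed

lemma q_int_0 [simp]: "q_int q 0 = 0"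
  by (simp add: q_int_def)

lemma q_fact_0 [simp]: "q_fact q 0 = 1"
  by (simp add: q_fact_def)

lemma q_fact_Suc: "q_fact q (Suc n) = q_fact q n * q_int q (Suc n)"
  by (simp add: q_fact_def)

lemma q_fact_nonzero:
  assumes "norm q \<noteq> 1"
  shows "q_fact q n \<noteq> 0"
  using assms by (simp add: q_fact_def q_int_nonzero)

lemma q_int_add:
  assumes "q \<noteq> 1"
  shows "q_int q (m + n) = q_int q n + q ^ n * q_int q m"
  using assms by (simp add: q_int_def field_simps power_add)

lemma q_binomial_0:
  assumes "norm q \<noteq> 1"
  shows "q_binomial q n 0 = 1"
  using q_fact_nonzero[OF assms] by (simp add: q_binomial_def)

text \<open>For k <= n both sides are [n]! / ([k+1]! [n-k]!); for k > n both vanish.\<close>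

lemma q_binomial_absorb:
  assumes "norm q \<noteq> 1"
  shows "q_binomial q n k / q_int q (Suc k) = q_binomial q (Suc n) (Suc k) / q_int q (Suc n)"
  using q_fact_nonzero[OF assms] q_int_nonzero[OF assms]
  by (auto simp: q_binomial_def q_fact_Suc field_simps)

lemma q_binomial_pascal:
  assumes "norm q \<noteq> 1"
  shows "q_binomial q (Suc n) (Suc k) = q ^ Suc k * q_binomial q n (Suc k) + q_binomial q n k"
proof -
  have nz: "q_fact q j \<noteq> 0" "q_int q (Suc j) \<noteq> 0" for j
    using q_fact_nonzero[OF assms] q_int_nonzero[OF assms] by auto
  have "q \<noteq> 1" using assms by auto
  consider "n < k" | "n = k" | r where "n = Suc (k + r)"
    by (metis less_imp_Suc_add linorder_neqE_nat)
  then show ?thesis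
  proof cases
    case 3
    \<comment> \<open>Once the factorials are cleared, the rule reduces to this splitting of
      [n+1].\<close>
    have "q_int q (Suc n) = q_int q (Suc k) + q ^ Suc k * q_int q (Suc r)"
      using q_int_add[OF \<open>q \<noteq> 1\<close>, of "Suc r" "Suc k"] 3 by (simp add: ac_simps)
    moreover have "n - k = Suc r" "n - Suc k = r" using 3 by auto
    ultimately show ?thesis using nz 3
      by (simp add: q_binomial_def q_fact_Suc[of q "Suc (k + r)"] q_fact_Suc[of q k] q_fact_Suc[of q r]
          divide_simps) (simp add: algebra_simps)
  qed (use nz in \<open>auto simp: q_binomial_def\<close>)
qed

section \<open>The binomial transform\<close>

lemma Const_mult: "Const (x * y) = Const x * Const y"
  by (simp add: Const_def mult_single)

lemma Const_add: "Const (x + y) = Const x + Const y"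
  by (simp add: Const_def single_add)

lemma Const_0 [simp]: "Const 0 = 0"
  by (simp add: Const_def)

lemma Const_1 [simp]: "Const 1 = 1"
  by (simp add: Const_def)

lemma Const_power: "Const (x ^ n) = Const x ^ n"
  by (induction n) (simp_all add: Const_mult)

lemma Const_prod: "Const (\<Prod>i\<in>A. f i) = (\<Prod>i\<in>A. Const (f i))"
  by (induction A rule: infinite_finite_induct) (simp_all add: Const_mult)

section \<open>Weights of the transform and the one-step recursion\<close>

definition weight :: "complex \<Rightarrow> complex \<Rightarrow> nat \<Rightarrow> nat \<Rightarrow> nat \<Rightarrow> complex"
  where "weight q a i n k = q_binomial q n k * q ^ (k choose 2) * a ^ (n - k) * q ^ (i * k)"

text \<open>
  The parameter \<open>i\<close> encodes the substitution \<open>x \<mapsto> q\<^sup>i x\<close>. The sum starts at \<open>k = 1\<close>,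
  so the value \<open>f 0\<close> plays no role.
\<close>

definition q_transform :: "complex \<Rightarrow> complex \<Rightarrow> nat \<Rightarrow> nat \<Rightarrow> (nat \<Rightarrow> tpoly) \<Rightarrow> tpoly poly"
  where "q_transform q a i n f = (\<Sum>k=1..n. monom (Const (weight q a i n k) * f k) k)"

lemma weight_0:
  assumes "norm q \<noteq> 1"
  shows "weight q a i n 0 = a ^ n"
  using assms by (simp add: weight_def q_binomial_0 binomial_eq_0)

text \<open>The factor q^(k+1) of the Pascal rule raises \<open>i\<close> in the first term; in the
  second, the difference k of the exponents (k+1 choose 2) and (k choose 2) does so.\<close>

lemma weight_pascal:
  assumes "norm q \<noteq> 1"
  shows "weight q a i (Suc n) (Suc k)
    = a * weight q a (Suc i) n (Suc k) + q ^ i * weight q a (Suc i) n k"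
proof (cases "k < n")
  case True
  then have "a ^ (n - k) = a * a ^ (n - Suc k)"
    by (metis Suc_diff_Suc power_Suc)
  then show ?thesis
    by (simp add: weight_def q_binomial_pascal[OF assms] numeral_2_eq_2 power_add algebra_simps)
next
  case False
  \<comment> \<open>The truncated exponent of \<open>a\<close> is harmless here, since its term has
    coefficient 0.\<close>
  then have "q_binomial q n (Suc k) = 0" by (simp add: q_binomial_def)
  then show ?thesis
    by (simp add: weight_def q_binomial_pascal[OF assms] numeral_2_eq_2 power_add algebra_simps)
qed

lemma weight_absorb:
  assumes "norm q \<noteq> 1"
  shows "q ^ i * weight q a (Suc i) n k * (1 / q_int q (Suc k))
    = 1 / q_int q (Suc n) * weight q a i (Suc n) (Suc k)"
proof -
  have "q ^ i * weight q a (Suc i) n k * (1 / q_int q (Suc k))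
      = (q_binomial q n k / q_int q (Suc k)) * (q ^ (Suc k choose 2) * a ^ (n - k) * q ^ (i * Suc k))"
    by (simp add: weight_def numeral_2_eq_2 power_add algebra_simps)
  also have "\<dots> = 1 / q_int q (Suc n) * weight q a i (Suc n) (Suc k)"
    by (subst q_binomial_absorb[OF assms]) (simp add: weight_def)
  finally show ?thesis .
qed

text \<open>The weight vanishes for k > n, so coefficients can be compared without an upper bound on
  k.\<close>

lemma coeff_q_transform:
  "coeff (q_transform q a i n f) k = (if k = 0 then 0 else Const (weight q a i n k) * f k)"
proof -
  have "coeff (q_transform q a i n f) k
      = (\<Sum>j=1..n. if j = k then Const (weight q a i n j) * f j else 0)"
    by (simp add: q_transform_def coeff_sum)
  also have "\<dots> = (if k \<in> {1..n} then Const (weight q a i n k) * f k else 0)"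
    by simp
  also have "\<dots> = (if k = 0 then 0 else Const (weight q a i n k) * f k)"
    by (auto simp: weight_def q_binomial_def)
  finally show ?thesis .
qed

definition weighted_sum :: "complex \<Rightarrow> tpoly \<Rightarrow> (nat \<Rightarrow> tpoly) \<Rightarrow> nat \<Rightarrow> tpoly"
  where "weighted_sum q t f k = (\<Sum>j=1..k. t ^ (k - j) * Const (1 / q_int q j) * f j)"

lemma weighted_sum_0 [simp]: "weighted_sum q t f 0 = 0"
  by (simp add: weighted_sum_def)

lemma weighted_sum_Suc:
  "weighted_sum q t f (Suc k) = t * weighted_sum q t f k + Const (1 / q_int q (Suc k)) * f (Suc k)"
  by (simp add: weighted_sum_def sum_distrib_left Suc_diff_le mult.assoc)

text \<open>
  At \<open>k = 0\<close> both sides vanish because \<open>1 / q_int q 0 = 1 / 0 = 0\<close>.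
\<close>

lemma weighted_sum_zero: "weighted_sum q 0 f k = Const (1 / q_int q k) * f k"
  by (cases k) (simp_all add: weighted_sum_Suc)

lemma q_transform_Suc:
  assumes "norm q \<noteq> 1"
  shows "q_transform q a i (Suc n) (weighted_sum q t f)
    = [:Const a, Const (q ^ i) * t:] * q_transform q a (Suc i) n (weighted_sum q t f)
      + smult (Const (1 / q_int q (Suc n))) (q_transform q a i (Suc n) f)"
proof (rule poly_eqI)
  fix k
  show "coeff (q_transform q a i (Suc n) (weighted_sum q t f)) k
    = coeff ([:Const a, Const (q ^ i) * t:] * q_transform q a (Suc i) n (weighted_sum q t f)
      + smult (Const (1 / q_int q (Suc n))) (q_transform q a i (Suc n) f)) k"
  proof (cases k)
    case 0
    then show ?thesis by (simp add: coeff_q_transform)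
  next
    case (Suc j)
    let ?g = "weighted_sum q t f"
    have "Const (weight q a i (Suc n) (Suc j)) * ?g (Suc j)
        = Const a * Const (weight q a (Suc i) n (Suc j)) * ?g (Suc j)
          + Const (q ^ i) * Const (weight q a (Suc i) n j) * ?g (Suc j)"
      by (simp add: weight_pascal[OF assms] Const_add Const_mult algebra_simps)
    \<comment> \<open>The recursion for \<open>?g\<close> is used in this summand only: its
      \<open>t\<close> part completes the linear factor, and the rest yields the transform of
      \<open>f\<close> by absorption.\<close>
    also have "Const (q ^ i) * Const (weight q a (Suc i) n j) * ?g (Suc j)
        = Const (q ^ i) * t * (Const (weight q a (Suc i) n j) * ?g j)
          + Const (q ^ i * weight q a (Suc i) n j * (1 / q_int q (Suc j))) * f (Suc j)"
      by (simp only: weighted_sum_Suc Const_mult distrib_left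
          mult.assoc mult.commute mult.left_commute)
    also have "\<dots> = Const (q ^ i) * t * (Const (weight q a (Suc i) n j) * ?g j)
          + Const (1 / q_int q (Suc n)) * (Const (weight q a i (Suc n) (Suc j)) * f (Suc j))"
      unfolding weight_absorb[OF assms] by (simp only: Const_mult mult.assoc)
    finally show ?thesis
      using Suc by (auto simp: coeff_q_transform coeff_pCons algebra_simps split: nat.splits)
  qed
qed

section \<open>Bracketed powers and the iterated recursion\<close>

lemma bracket_power_0 [simp]: "bracket_power q \<alpha> \<beta> 0 = 1"
  by (simp add: bracket_power_def)

text \<open>Removing the first factor shifts the index of the others, which moves one
  \<open>q\<close> into the coefficient of x.\<close>

lemma bracket_power_Suc:
  "bracket_power q (Const (q ^ i) * t) \<beta> (Suc n)
    = [:\<beta>, Const (q ^ i) * t:] * bracket_power q (Const (q ^ Suc i) * t) \<beta> n"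
proof -
  have "bracket_power q (Const (q ^ i) * t) \<beta> (Suc n)
      = (\<Prod>k\<in>{0..<Suc n}. [:\<beta>, Const (q ^ k) * (Const (q ^ i) * t):])"
    unfolding bracket_power_def
    by (rule prod.reindex_bij_witness[where i = Suc and j = "\<lambda>k. k - 1"]) auto
  also have "\<dots> = [:\<beta>, Const (q ^ i) * t:]
      * (\<Prod>k\<in>{0..<n}. [:\<beta>, Const (q ^ Suc k) * (Const (q ^ i) * t):])"
    by (subst prod.atLeast0_lessThan_Suc_shift) simp
  also have "(\<Prod>k\<in>{0..<n}. [:\<beta>, Const (q ^ Suc k) * (Const (q ^ i) * t):])
      = bracket_power q (Const (q ^ Suc i) * t) \<beta> n"
    unfolding bracket_power_def
    by (rule prod.reindex_bij_witness[where j = Suc and i = "\<lambda>k. k - 1"])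
       (auto simp: Const_mult ac_simps)
  finally show ?thesis .
qed

lemma bracket_power_zero: "bracket_power q 0 \<beta> n = [:\<beta> ^ n:]"
  by (simp add: bracket_power_def pCons_one poly_const_pow)

lemma q_transform_weighted_sum:
  assumes "norm q \<noteq> 1"
  shows "q_transform q a i n (weighted_sum q t f)
    = (\<Sum>j=1..n. smult (Const (1 / q_int q j)) (bracket_power q (Const (q ^ i) * t) (Const a) (n - j))
        * q_transform q a (i + (n - j)) j f)"
proof (induction n arbitrary: i)
  case 0
  then show ?case by (simp add: q_transform_def)
next
  case (Suc n)
  let ?b = "\<lambda>i j. bracket_power q (Const (q ^ i) * t) (Const a) j"
  \<comment> \<open>The linear factor lengthens each bracketed power of the induction hypothesis by
    one; the term \<open>j = Suc n\<close>, with empty power, comes from the recursion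
    itself.\<close>
  have "[:Const a, Const (q ^ i) * t:] * q_transform q a (Suc i) n (weighted_sum q t f)
      = (\<Sum>j=1..n. smult (Const (1 / q_int q j)) (?b i (Suc n - j))
          * q_transform q a (i + (Suc n - j)) j f)"
    unfolding Suc.IH sum_distrib_left
  proof (rule sum.cong)
    fix j assume "j \<in> {1..n}"
    then have "Suc n - j = Suc (n - j)" by auto
    then show "[:Const a, Const (q ^ i) * t:]
          * (smult (Const (1 / q_int q j)) (?b (Suc i) (n - j)) * q_transform q a (Suc i + (n - j)) j f)
        = smult (Const (1 / q_int q j)) (?b i (Suc n - j)) * q_transform q a (i + (Suc n - j)) j f"
      by (simp only: bracket_power_Suc mult_smult_left mult_smult_right mult.assoc
          add_Suc add_Suc_right)
  qed simp
  then show ?case by (simp add: q_transform_Suc[OF assms])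
qed

text \<open>The transform lacks the term k = 0, which is a^n. This is the source of the subtracted
  power of \<open>a\<close> in the theorem.\<close>

lemma q_binomial_theorem:
  assumes "norm q \<noteq> 1"
  shows "q_transform q a i n (\<lambda>k. t ^ k)
    = bracket_power q (Const (q ^ i) * t) (Const a) n - [:Const (a ^ n):]"
proof (induction n arbitrary: i)
  case 0
  then show ?case by (simp add: q_transform_def pCons_one)
next
  case (Suc n)
  \<comment> \<open>With the constant term restored, the Pascal rule for the weights is exactly
    multiplication by a linear factor.\<close>
  let ?f = "\<lambda>i n. q_transform q a i n (\<lambda>k. t ^ k) + [:Const (a ^ n):]"
  have coeff: "coeff (?f i n) k = Const (weight q a i n k) * t ^ k" for i n k
    by (simp add: coeff_q_transform coeff_pCons weight_0[OF assms] split: nat.splits)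
  have "?f i (Suc n) = [:Const a, Const (q ^ i) * t:] * ?f (Suc i) n"
  proof (rule poly_eqI)
    fix k
    have "coeff ([:Const a, Const (q ^ i) * t:] * ?f (Suc i) n) k
        = Const a * coeff (?f (Suc i) n) k
          + (case k of 0 \<Rightarrow> 0 | Suc j \<Rightarrow> Const (q ^ i) * t * coeff (?f (Suc i) n) j)"
      by (simp only: mult_pCons_left coeff_add coeff_smult coeff_pCons mult_zero_left add_0_right
          split: nat.splits) simp
    also have "\<dots> = Const (weight q a i (Suc n) k) * t ^ k"
      unfolding coeff
      by (simp add: weight_0[OF assms] weight_pascal[OF assms] Const_mult Const_add algebra_simps
          split: nat.splits)
    finally show "coeff (?f i (Suc n)) k = coeff ([:Const a, Const (q ^ i) * t:] * ?f (Suc i) n) k"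
      unfolding coeff by simp
  qed
  moreover have "?f (Suc i) n = bracket_power q (Const (q ^ Suc i) * t) (Const a) n"
    using Suc.IH[of "Suc i"] by simp
  ultimately have "?f i (Suc n) = bracket_power q (Const (q ^ i) * t) (Const a) (Suc n)"
    by (simp only: bracket_power_Suc)
  then show ?case by (simp add: eq_diff_eq)
qed

lemma q_transform_chain_sum:
  assumes "norm q \<noteq> 1"
  shows "q_transform q a 0 n
      (\<lambda>k. chain_sum (\<lambda>i p j. \<tau> i ^ (p - j) * Const (1 / q_int q j)) w k f)
    = chain_sum (\<lambda>i p j. smult (Const (1 / q_int q j))
          (bracket_power q (Const (q ^ (n - p)) * \<tau> i) (Const a) (p - j)))
        w n (\<lambda>p. q_transform q a (n - p) p f)"
    (is "_ = chain_sum ?\<psi> w n _")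
proof (induction w arbitrary: f)
  case 0
  then show ?case by simp
next
  case (Suc w)
  have "q_transform q a 0 n
      (\<lambda>k. chain_sum (\<lambda>i p j. \<tau> i ^ (p - j) * Const (1 / q_int q j)) (Suc w) k f)
    = chain_sum ?\<psi> w n (\<lambda>p. q_transform q a (n - p) p (weighted_sum q (\<tau> (Suc w)) f))"
    by (simp only: chain_sum_Suc Suc.IH weighted_sum_def[abs_def])
  also have "\<dots> = chain_sum ?\<psi> w n
      (\<lambda>p. \<Sum>j=1..p. ?\<psi> (Suc w) p j * q_transform q a (n - j) j f)"
    \<comment> \<open>Only p <= n occurs, so the shifts add up: (n - p) + (p - j) = n - j.\<close>
    by (intro chain_sum_cong) (simp add: q_transform_weighted_sum[OF assms])
  finally show ?case by (simp only: chain_sum_Suc)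
qed

section \<open>Blocks of chains\<close>

definition block_end :: "(nat \<Rightarrow> nat) \<Rightarrow> nat \<Rightarrow> nat"
  where "block_end s i = (\<Sum>j=1..i. s j)"

text \<open>For positive \<open>s\<close> the block starts are distinct, so the sum acts as a case
  distinction with value 0 off the starts.\<close>

definition block_param :: "(nat \<Rightarrow> nat) \<Rightarrow> nat \<Rightarrow> nat \<Rightarrow> tpoly"
  where "block_param s d i =
    (\<Sum>r<d. if i = Suc (block_end s r) then (if r = 0 then 1 else Var r) else 0)"

lemma block_end_0 [simp]: "block_end s 0 = 0"
  by (simp add: block_end_def)

lemma block_end_Suc: "block_end s (Suc d) = block_end s d + s (Suc d)"
  by (simp add: block_end_def)

lemma block_end_mono: "i \<le> j \<Longrightarrow> block_end s i \<le> block_end s j"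
  by (auto simp: block_end_def intro: sum_mono2)

lemma block_end_less:
  assumes "i < j" "\<And>i. i \<in> {1..j} \<Longrightarrow> s i > 0"
  shows "block_end s i < block_end s j"
proof -
  have "block_end s i < block_end s (Suc i)" using assms by (simp add: block_end_Suc)
  also have "\<dots> \<le> block_end s j" using assms by (intro block_end_mono) auto
  finally show ?thesis .
qed

lemma block_end_inj:
  assumes "i \<le> d" "j \<le> d" "\<And>i. i \<in> {1..d} \<Longrightarrow> s i > 0" "block_end s i = block_end s j"
  shows "i = j"
  using block_end_less[of i j s] block_end_less[of j i s] assms
  by (metis atLeastAtMost_iff le_trans less_irrefl linorder_neqE_nat)

lemma block_param_start:
  assumes "\<And>i. i \<in> {1..d} \<Longrightarrow> s i > 0" "r < d"
  shows "block_param s d (Suc (block_end s r)) = (if r = 0 then 1 else Var r)"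
proof -
  have "Suc (block_end s r) = Suc (block_end s i) \<longleftrightarrow> i = r" if "i < d" for i
    using block_end_inj[of r d i s] assms that by auto
  then have "block_param s d (Suc (block_end s r))
      = (\<Sum>i<d. if i = r then (if i = 0 then 1 else Var i) else 0)"
    unfolding block_param_def by (intro sum.cong) auto
  then show ?thesis using assms by (simp add: sum.delta')
qed

lemma block_param_inner:
  assumes "Suc (block_end s r) < i" "i \<le> block_end s (Suc r)"
  shows "block_param s d i = 0"
proof -
  have "i \<noteq> Suc (block_end s j)" for j
  proof (cases "j \<le> r")
    case True
    then show ?thesis using block_end_mono[of j r s] assms by auto
  next
    case False
    then show ?thesis using block_end_mono[of "Suc r" j s] assms by auto
  qed
  then show ?thesis by (simp add: block_param_def)
qed

text \<open>As 0^0 = 1, a kernel with parameter 0 is diagonal, and each of the last \<open>r\<close>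
  steps only divides by [j].\<close>

lemma chain_sum_zero_params:
  assumes "\<And>i. w < i \<Longrightarrow> i \<le> w + r \<Longrightarrow> \<tau> i = 0"
  shows "chain_sum (\<lambda>i p j. \<tau> i ^ (p - j) * Const (1 / q_int q j)) (w + r) k f
    = chain_sum (\<lambda>i p j. \<tau> i ^ (p - j) * Const (1 / q_int q j)) w k
        (\<lambda>j. Const (1 / q_int q j) ^ r * f j)"
  using assms
proof (induction r arbitrary: f)
  case 0
  then show ?case by simp
next
  case (Suc r)
  have "(\<lambda>p. \<Sum>j=1..p. \<tau> (Suc (w + r)) ^ (p - j) * Const (1 / q_int q j) * f j)
      = (\<lambda>p. Const (1 / q_int q p) * f p)"
    using weighted_sum_zero[of q f] Suc.prems[of "Suc (w + r)"] by (auto simp: weighted_sum_def)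
  then show ?case
    using Suc by (simp only: add_Suc_right chain_sum_Suc) (simp add: ac_simps)
qed

text \<open>A block collapses to one entry: its first step carries the parameter and one factor
  1/[j], the others supply the remaining \<open>s i - 1\<close> factors.\<close>

lemma chain_sum_blocks:
  assumes "\<And>i. i \<in> {1..d} \<Longrightarrow> s i > 0" "e \<le> d"
  shows "chain_sum (\<lambda>i p j. block_param s d i ^ (p - j) * Const (1 / q_int q j)) (block_end s e) k f
    = chain_sum (\<lambda>i p j. (if i = 1 then 1 else Var (i - 1)) ^ (p - j) * Const (1 / q_int q j) ^ s i)
        e k f"
  using assms(2)
proof (induction e arbitrary: f)
  case 0
  then show ?case by simp
next
  case (Suc e)
  define r where "r = s (Suc e) - 1"
  have r: "s (Suc e) = Suc r" using assms(1)[of "Suc e"] Suc.prems by (simp add: r_def)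
  have bl: "block_end s (Suc e) = Suc (block_end s e) + r" by (simp add: block_end_Suc r)
  have "block_param s d i = 0" if "Suc (block_end s e) < i" "i \<le> Suc (block_end s e) + r" for i
    using block_param_inner[of s e i d] that bl by simp
  then have "chain_sum (\<lambda>i p j. block_param s d i ^ (p - j) * Const (1 / q_int q j))
        (block_end s (Suc e)) k f
      = chain_sum (\<lambda>i p j. block_param s d i ^ (p - j) * Const (1 / q_int q j))
        (Suc (block_end s e)) k (\<lambda>j. Const (1 / q_int q j) ^ r * f j)"
    unfolding bl by (rule chain_sum_zero_params)
  then show ?case
    using Suc block_param_start[of d s e, OF assms(1)]
    by (simp only: chain_sum_Suc) (auto simp: r mult.assoc)
qed

lemma l_star_eq_chain_sum:
  assumes "\<And>i. i \<in> {1..d} \<Longrightarrow> s i > 0" "d \<ge> 1"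
  shows "l_star q k d s
    = chain_sum (\<lambda>i p j. block_param s d i ^ (p - j) * Const (1 / q_int q j)) (block_end s d) k
        (\<lambda>p. Var d ^ p)"
proof -
  let ?c = "\<lambda>i p j. (if i = 1 then 1 else Var (i - 1)) ^ (p - j) * Const (1 / q_int q j) ^ s i"
  have "chain_sum ?c d k (\<lambda>p. Var d ^ p) = l_star q k d s"
    unfolding chain_sum_def l_star_def
  proof (rule sum.cong[OF refl])
    fix m :: "nat \<Rightarrow> nat"
    obtain e where e: "d = Suc e" using assms(2) by (cases d) auto
    \<comment> \<open>The parameter 1 at \<open>i = 1\<close> removes the exponent k - m_1; the
      other indices shift by one.\<close>
    have "(\<Prod>i=1..d. (if i = 1 then 1 else Var (i - 1)) ^ ((m(0:=k)) (i - 1) - (m(0:=k)) i))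
        = (\<Prod>i=2..d. Var (i - 1) ^ (m (i - 1) - m i))"
      by (rule prod.mono_neutral_cong_right) auto
    also have "\<dots> = (\<Prod>i=1..<d. Var i ^ (m i - m (i + 1)))"
      by (rule prod.reindex_bij_witness[where i = Suc and j = "\<lambda>i. i - 1"]) auto
    finally have V: "(\<Prod>i=1..d. (if i = 1 then 1 else Var (i - 1))
          ^ ((m(0:=k)) (i - 1) - (m(0:=k)) i)) = (\<Prod>i=1..<d. Var i ^ (m i - m (i + 1)))" .
    have C: "(\<Prod>i=1..d. Const (1 / q_int q ((m(0:=k)) i)) ^ s i)
        = Const (1 / (\<Prod>i=1..d. q_int q (m i) ^ s i))"
      by (simp flip: Const_power Const_prod add: power_divide prod_dividef)
    show "(\<Prod>i=1..d. ?c i ((m(0:=k)) (i - 1)) ((m(0:=k)) i)) * Var d ^ (m(0:=k)) d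
        = Const (1 / (\<Prod>i=1..d. q_int q (m i) ^ s i))
          * ((\<Prod>i=1..<d. Var i ^ (m i - m (i + 1))) * Var d ^ m d)"
      unfolding prod.distrib V C using e by (simp add: ac_simps)
  qed
  then show ?thesis using chain_sum_blocks[OF assms(1), where e = d] by simp
qed

text \<open>In each block only the first factor stays a bracketed power; the others are powers of
  \<open>a\<close> whose exponents telescope.\<close>

lemma prod_bracket_power_blocks:
  fixes m' :: "nat \<Rightarrow> nat"
  assumes "\<And>i. i \<in> {1..d} \<Longrightarrow> s i > 0" "1 \<le> e" "e \<le> d"
    and anti: "\<And>i j. 1 \<le> i \<Longrightarrow> i \<le> j \<Longrightarrow> j \<le> block_end s d \<Longrightarrow> m j \<le> m i"
    and m': "m' = m(0 := n)"
  shows "(\<Prod>i=1..block_end s e.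
        bracket_power q (Const (q ^ (n - m' (i - 1))) * block_param s d i) (Const a) (m' (i - 1) - m' i))
    = bracket_power q 1 (Const a) (n - m 1)
      * (\<Prod>r=1..e-1. bracket_power q (Const (q ^ (n - m (block_end s r))) * Var r) (Const a)
           (m (block_end s r) - m (block_end s r + 1)))
      * [:Const (a ^ (\<Sum>r=1..e. m (block_end s (r - 1) + 1) - m (block_end s r))):]"
    (is "prod ?g _ = _")
proof -
  have block: "prod ?g {Suc (block_end s r)..block_end s (Suc r)}
      = ?g (Suc (block_end s r)) * [:Const (a ^ (m (block_end s r + 1) - m (block_end s (Suc r)))):]"
    if "r < d" for r
  proof -
    let ?p = "Suc (block_end s r)"
    have "prod ?g {Suc (block_end s r)..p} = ?g ?p * [:Const (a ^ (m ?p - m p)):]"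
      if "?p \<le> p" "p \<le> block_end s (Suc r)" for p
      using that
    proof (induction p rule: dec_induct)
      case base
      show ?case by (simp add: pCons_one)
    next
      case (step p)
      have "?p \<le> p" "Suc p \<le> block_end s d"
        using step block_end_mono[of "Suc r" d s] \<open>r < d\<close> by auto
      then have le: "m p \<le> m ?p" "m (Suc p) \<le> m p" using anti by auto
      have "block_param s d (Suc p) = 0"
        using step by (intro block_param_inner[of s r]) auto
      then have "?g (Suc p) = [:Const (a ^ (m p - m (Suc p))):]"
        using step by (simp add: m' bracket_power_zero Const_power)
      moreover have "a ^ (m ?p - m (Suc p)) = a ^ (m ?p - m p) * a ^ (m p - m (Suc p))"
        using le by (simp flip: power_add)
      ultimately show ?case
        using step by (simp add: Const_mult prod.nat_ivl_Suc' mult.assoc mult.commute)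
    qed
    moreover have "?p \<le> block_end s (Suc r)"
      using assms(1)[of "Suc r"] that by (simp add: block_end_Suc)
    ultimately show ?thesis by simp
  qed
  have split: "prod ?g {1..block_end s (Suc r)}
      = prod ?g {1..block_end s r} * prod ?g {Suc (block_end s r)..block_end s (Suc r)}" for r
    using prod.ub_add_nat[of 1 "block_end s r" ?g "s (Suc r)"] by (simp add: block_end_Suc)
  show ?thesis using assms(2,3)
  proof (induction e rule: dec_induct)
    case base
    have "block_param s d (Suc 0) = 1"
      using block_param_start[of d s 0, OF assms(1)] base by simp
    then have "?g 1 = bracket_power q 1 (Const a) (n - m 1)"
      by (simp add: m')
    then show ?case using split[of 0] block[of 0] base by simp
  next
    case (step e)
    \<comment> \<open>The index is positive, so the update at 0 leaves this entry equal to that of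
      \<open>m\<close>.\<close>
    have "block_end s e > 0" using block_end_less[of 0 e s] assms(1) step by auto
    then have g: "?g (Suc (block_end s e))
        = bracket_power q (Const (q ^ (n - m (block_end s e))) * Var e) (Const a)
           (m (block_end s e) - m (block_end s e + 1))"
      using block_param_start[of d s e, OF assms(1)] step by (simp add: m')
    have "{1..Suc e - 1} = insert e {1..e-1}" using step by auto
    then show ?case
      using split[of e] block[of e] step
      unfolding g by (simp add: power_add Const_mult prod.insert ac_simps)
  qed
qed

theorem theorem4p2:
  fixes q a :: complex and d n w :: nat and s l :: "nat \<Rightarrow> nat"
  assumes "norm q \<noteq> 0" and "norm q \<noteq> 1"
    and "d \<ge> 1"
    and "\<And>i. i \<in> {1..d} \<Longrightarrow> s i > 0"
    and "l = (\<lambda>i. \<Sum>j=1..i. s j)"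
    and "w = l d"
    and "n \<ge> 1"
  shows "(\<Sum>k=1..n.
           monom (Const (q_binomial q n k * q ^ (k choose 2) * a ^ (n - k)) * l_star q k d s) k)
       = (\<Sum>m\<in>desc_chains w n.
           smult (Const (1 / (\<Prod>i=1..w. q_int q (m i)))) (bracket_power q 1 (Const a) (n - m 1))
           * (\<Prod>r=1..d-1. bracket_power q (Const (q ^ (n - m (l r))) * Var r) (Const a)
                             (m (l r) - m (l r + 1)))
           * (bracket_power q (Const (q ^ (n - m (l d))) * Var d) (Const a) (m (l d))
              - [:Const (a ^ m (l d)):])
           * [:Const (a ^ ((\<Sum>r=1..d. m (l (r - 1) + 1)) - (\<Sum>r=1..d. m (l r)))):])"
proof -
  have l: "l = block_end s" using assms(5) by (auto simp: block_end_def)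
  have w: "w = block_end s d" using assms(6) l by simp
  have "w > 0" using block_end_less[of 0 d s] assms(3,4) w by auto
  let ?\<psi> = "\<lambda>i p j. smult (Const (1 / q_int q j))
      (bracket_power q (Const (q ^ (n - p)) * block_param s d i) (Const a) (p - j))"
  have "(\<Sum>k=1..n.
        monom (Const (q_binomial q n k * q ^ (k choose 2) * a ^ (n - k)) * l_star q k d s) k)
      = q_transform q a 0 n (\<lambda>k. l_star q k d s)"
    by (simp add: q_transform_def weight_def)
  also have "\<dots> = chain_sum ?\<psi> w n (\<lambda>p. q_transform q a (n - p) p (\<lambda>k. Var d ^ k))"
    by (simp only: l_star_eq_chain_sum[OF assms(4,3)] q_transform_chain_sum[OF assms(2)] w)
  also have "\<dots> = chain_sum ?\<psi> w n
      (\<lambda>p. bracket_power q (Const (q ^ (n - p)) * Var d) (Const a) p - [:Const (a ^ p):])"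
    by (simp only: q_binomial_theorem[OF assms(2)])
  also have "\<dots> = (\<Sum>m\<in>desc_chains w n.
           smult (Const (1 / (\<Prod>i=1..w. q_int q (m i)))) (bracket_power q 1 (Const a) (n - m 1))
           * (\<Prod>r=1..d-1. bracket_power q (Const (q ^ (n - m (l r))) * Var r) (Const a)
                             (m (l r) - m (l r + 1)))
           * (bracket_power q (Const (q ^ (n - m (l d))) * Var d) (Const a) (m (l d))
              - [:Const (a ^ m (l d)):])
           * [:Const (a ^ ((\<Sum>r=1..d. m (l (r - 1) + 1)) - (\<Sum>r=1..d. m (l r)))):])"
    unfolding chain_sum_def
  proof (rule sum.cong[OF refl])
    fix m assume m: "m \<in> desc_chains w n"
    define m' where "m' = m(0 := n)"
    let ?b = "\<lambda>i. bracket_power q (Const (q ^ (n - m' (i - 1))) * block_param s d i) (Const a)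
      (m' (i - 1) - m' i)"
    have anti: "m j \<le> m i" if "1 \<le> i" "i \<le> j" "j \<le> block_end s d" for i j
      using desc_chains_antimono[OF m] that w by auto
    have "m (l r) \<le> m (l (r - 1) + 1)" if "r \<in> {1..d}" for r
    proof -
      have "l (r - 1) < l r" "l r \<le> l d"
        unfolding l using that assms(4) by (auto intro: block_end_less block_end_mono)
      then show ?thesis using anti[of "l (r - 1) + 1" "l r"] by (simp add: l)
    qed
    \<comment> \<open>Each difference is nonnegative along the chain, so truncated subtraction
      commutes with the sum.\<close>
    then have ex: "(\<Sum>r=1..d. m (l (r - 1) + 1)) - (\<Sum>r=1..d. m (l r))
        = (\<Sum>r=1..d. m (l (r - 1) + 1) - m (l r))"
      by (rule sum_subtractf_nat[symmetric])
    have "(\<Prod>i=1..w. ?\<psi> i (m' (i - 1)) (m' i))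
        = smult (Const (\<Prod>i=1..w. 1 / q_int q (m' i))) (\<Prod>i=1..w. ?b i)"
      by (simp only: prod_smult Const_prod)
    also have "(\<Prod>i=1..w. 1 / q_int q (m' i)) = 1 / (\<Prod>i=1..w. q_int q (m i))"
      by (simp add: prod_dividef m'_def)
    finally have P: "(\<Prod>i=1..w. ?\<psi> i (m' (i - 1)) (m' i))
        = smult (Const (1 / (\<Prod>i=1..w. q_int q (m i)))) (\<Prod>i=1..w. ?b i)" .
    have B: "(\<Prod>i=1..w. ?b i) = bracket_power q 1 (Const a) (n - m 1)
      * (\<Prod>r=1..d-1. bracket_power q (Const (q ^ (n - m (l r))) * Var r) (Const a)
           (m (l r) - m (l r + 1)))
      * [:Const (a ^ (\<Sum>r=1..d. m (l (r - 1) + 1) - m (l r))):]"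
      unfolding l w
      by (rule prod_bracket_power_blocks[OF assms(4) assms(3) order_refl anti m'_def])
    have "m' w = m (l d)" using \<open>w > 0\<close> assms(6) by (simp add: m'_def)
    then show "(\<Prod>i=1..w. ?\<psi> i ((m(0 := n)) (i - 1)) ((m(0 := n)) i))
          * (bracket_power q (Const (q ^ (n - (m(0 := n)) w)) * Var d) (Const a) ((m(0 := n)) w)
             - [:Const (a ^ (m(0 := n)) w):])
        = smult (Const (1 / (\<Prod>i=1..w. q_int q (m i)))) (bracket_power q 1 (Const a) (n - m 1))
           * (\<Prod>r=1..d-1. bracket_power q (Const (q ^ (n - m (l r))) * Var r) (Const a)
                             (m (l r) - m (l r + 1)))
           * (bracket_power q (Const (q ^ (n - m (l d))) * Var d) (Const a) (m (l d))
              - [:Const (a ^ m (l d)):])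
           * [:Const (a ^ ((\<Sum>r=1..d. m (l (r - 1) + 1)) - (\<Sum>r=1..d. m (l r)))):]"
      unfolding m'_def[symmetric] P B ex
      by (simp only: mult_smult_left mult_smult_right mult.assoc mult.commute mult.left_commute)
  qed
  finally show ?thesis .
qed

end
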